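(* Let $b$ be a nonzero integer and suppose $0\in\chi(0,b)$. Let $p$ be an odd prime that is a $0$-PL prime relative to $(0,b)$. Then for every integer $q\geq 1$, the wheel graph $W_{q\pi_p(0,b)+1}$ is a $(0,b)$-FLC graph modulo $p$.
   Context: For integers $a,b$, the $(a,b)$-Fibonacci sequence is $F_0=a$, $F_1=b$, $F_n=F_{n-1}+F_{n-2}$ for $n\ge 2$. $(x/p)$ denotes the Legendre symbol for an odd prime $p$ (equal to $0$ when $p\mid x$). The $(a,b)$-Pisano period $\pi_p(a,b)$ is the smallest positive integer $t$ such that $F_{n+t}\equiv F_n \pmod p$ for all $n\ge 0$. For an odd prime $p$ and $j\in\{-1,0,1\}$, let $\Lambda_j^p(a,b)=\{\xi\in\{0,1,\ldots,\pi_p(a,b)-1\} : (F_\xi/p)=j\}$. The prime $p$ is a $k$-PL prime ($k$-Pisano-Legendre prime) relative to $(a,b)$ if $k=|\Lambda_1^p(a,b)|-|\Lambda_{-1}^p(a,b)|-|\Lambda_0^p(a,b)|$. The Pisano set $\chi(a,b)$ is the set of all integers $k$ for which there exists an odd prime $p$ that is a $k$-PL prime relative to $(a,b)$. Let $G$ be a simple connected graph of order (number of vertices) $n$. A bijection $f:V(G)\to\{0,1,\ldots,n-1\}$ is an $(a,b)$-FLC labeling (Fibonacci-Legendre cordial labeling) modulo $p$ if the induced edge labeling $f_p^*:E(G)\to\{0,1\}$, given by $f_p^*(uv)=\frac{1+([F_{f(u)}+F_{f(v)}]/p)}{2}$ if $F_{f(u)}+F_{f(v)}\not\equiv 0\pmod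 p$ and $f_p^*(uv)=0$ otherwise, satisfies $|e_{f_p^*}(0)-e_{f_p^*}(1)|\le 1$, where $e_{f_p^*}(i)$ is the number of edges labeled $i$. A graph admitting such a labeling is an $(a,b)$-FLC graph modulo $p$. The cycle graph $C_n$ has vertices $v_1,\ldots,v_n$ and edges $v_iv_{i+1}$ ($1\le i\le n-1$) and $v_1v_n$. The wheel graph $W_n$ of order $n$ is obtained from the cycle $C_{n-1}$ by adding one new vertex $x_0$ adjacent to every vertex of $C_{n-1}$. *)

theory Defs
  imports "HOL-Number_Theory.Number_Theory"
begin

fun gfib :: "int \<Rightarrow> int \<Rightarrow> nat \<Rightarrow> int" where
  "gfib a b 0 = a"
| "gfib a b (Suc 0) = b"
| "gfib a b (Suc (Suc n)) = gfib a b (Suc n) + gfib a b n"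

(* For p > 0 the set below is nonempty: the pairs of consecutive terms modulo p are finite in
   number and the recurrence is invertible, so the least element is the genuine period. *)
definition pisano_period :: "nat \<Rightarrow> int \<Rightarrow> int \<Rightarrow> nat" where
  "pisano_period p a b =
     (LEAST t. 0 < t \<and> (\<forall>n. [gfib a b (n + t) = gfib a b n] (mod int p)))"

definition Lambda_set :: "int \<Rightarrow> nat \<Rightarrow> int \<Rightarrow> int \<Rightarrow> nat set" where
  "Lambda_set j p a b = {\<xi> \<in> {0..<pisano_period p a b}. Legendre (gfib a b \<xi>) (int p) = j}"

definition PL_prime :: "int \<Rightarrow> nat \<Rightarrow> int \<Rightarrow> int \<Rightarrow> bool" where
  "PL_prime k p a b \<longleftrightarrow> prime p \<and> odd p \<and>
     k = int (card (Lambda_set 1 p a b)) - int (card (Lambda_set (-1) p a b))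
         - int (card (Lambda_set 0 p a b))"

definition pisano_set :: "int \<Rightarrow> int \<Rightarrow> int set" where
  "pisano_set a b = {k. \<exists>p. PL_prime k p a b}"

(* A graph is a pair of a vertex set and a set of edges; an edge is the set of its endpoints. *)
type_synonym 'a graph = "'a set \<times> 'a set set"

definition verts :: "'a graph \<Rightarrow> 'a set" where
  "verts G = fst G"

definition edges :: "'a graph \<Rightarrow> 'a set set" where
  "edges G = snd G"

(* Requiring card e = 2 excludes loops. *)
definition simple_graph :: "'a graph \<Rightarrow> bool" where
  "simple_graph G \<longleftrightarrow> finite (verts G) \<and> (\<forall>e \<in> edges G. e \<subseteq> verts G \<and> card e = 2)"

definition connected_graph :: "'a graph \<Rightarrow> bool" where
  "connected_graph G \<longleftrightarrow> verts G \<noteq> {} \<and>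
     (\<forall>u \<in> verts G. \<forall>v \<in> verts G. (u, v) \<in> {(x, y). {x, y} \<in> edges G}\<^sup>*)"

(* The division by 2 is exact: in the else-branch the Legendre symbol is 1 or -1. *)
definition edge_label :: "int \<Rightarrow> int \<Rightarrow> nat \<Rightarrow> ('a \<Rightarrow> nat) \<Rightarrow> 'a \<Rightarrow> 'a \<Rightarrow> int" where
  "edge_label a b p f u v =
     (if [gfib a b (f u) + gfib a b (f v) = 0] (mod int p) then 0
      else (1 + Legendre (gfib a b (f u) + gfib a b (f v)) (int p)) div 2)"

(* Since edge_label is symmetric in u and v, every edge receives exactly one label. *)
definition label_count ::
    "int \<Rightarrow> int \<Rightarrow> nat \<Rightarrow> 'a graph \<Rightarrow> ('a \<Rightarrow> nat) \<Rightarrow> int \<Rightarrow> nat" where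
  "label_count a b p G f i = card {{u, v} | u v. {u, v} \<in> edges G \<and> edge_label a b p f u v = i}"

definition FLC_labeling :: "int \<Rightarrow> int \<Rightarrow> nat \<Rightarrow> 'a graph \<Rightarrow> ('a \<Rightarrow> nat) \<Rightarrow> bool" where
  "FLC_labeling a b p G f \<longleftrightarrow>
     bij_betw f (verts G) {0..<card (verts G)} \<and>
     \<bar>int (label_count a b p G f 0) - int (label_count a b p G f 1)\<bar> \<le> 1"

definition FLC_graph :: "int \<Rightarrow> int \<Rightarrow> nat \<Rightarrow> 'a graph \<Rightarrow> bool" where
  "FLC_graph a b p G \<longleftrightarrow>
     simple_graph G \<and> connected_graph G \<and> (\<exists>f. FLC_labeling a b p G f)"

(* The vertex v_i is the number i. This is the cycle graph for n \<ge> 3 only. *)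
definition cycle_graph :: "nat \<Rightarrow> nat graph" where
  "cycle_graph n = ({1..n}, {{i, i + 1} | i. 1 \<le> i \<and> i \<le> n - 1} \<union> {{1, n}})"

(* The hub is 0, which is not a vertex of the cycle; the argument n is the order of the wheel,
   so this is the wheel graph for n \<ge> 4 only. *)
definition wheel_graph :: "nat \<Rightarrow> nat graph" where
  "wheel_graph n =
     (insert 0 (verts (cycle_graph (n - 1))),
      edges (cycle_graph (n - 1)) \<union> {{0, v} | v. v \<in> verts (cycle_graph (n - 1))})"

end

theory Submission
  imports Defs
begin

text \<open>
  Give the hub the label \<open>0\<close> and the \<open>i\<close>-th rim vertex the label \<open>i\<close>. Since \<open>F\<^sub>0 = 0\<close>, the
  spokes carry the Legendre symbols of \<open>F\<^sub>1, \<dots>, F\<^sub>N\<close>, where \<open>N\<close> is \<open>q\<close> times the period. By the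
  recurrence, and by periodicity for the closing edge, the rim edges carry those of
  \<open>F\<^sub>3, \<dots>, F\<^sub>N\<^sub>+\<^sub>2\<close>. Each family runs through \<open>q\<close> full periods, and being a 0-PL prime means that
  exactly half of the indices in a period give the symbol \<open>1\<close>.
\<close>

section \<open>Periodicity of the recurrence modulo m\<close>

lemma gfib_congI:
  assumes "[gfib a b i = gfib a b j] (mod m)"
    and "[gfib a b (Suc i) = gfib a b (Suc j)] (mod m)"
  shows "[gfib a b (n + i) = gfib a b (n + j)] (mod m)"
proof -
  have "[gfib a b (n + i) = gfib a b (n + j)] (mod m) \<and>
        [gfib a b (Suc (n + i)) = gfib a b (Suc (n + j))] (mod m)"
    using assms by (induction n) (auto intro: cong_add)
  then show ?thesis ..
qed

text \<open>The recurrence runs backwards as a difference of later terms. A repeated pair can thus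
  be pulled back to the start, which makes the sequence purely periodic, with no preperiod.\<close>

lemma gfib_cong_back:
  assumes "[gfib a b (n + i) = gfib a b (n + j)] (mod m)"
    and "[gfib a b (Suc (n + i)) = gfib a b (Suc (n + j))] (mod m)"
  shows "[gfib a b i = gfib a b j] (mod m) \<and> [gfib a b (Suc i) = gfib a b (Suc j)] (mod m)"
  using assms
proof (induction n)
  case (Suc n)
  have "[gfib a b (n + i) = gfib a b (n + j)] (mod m)"
    using cong_diff[OF Suc.prems(2) Suc.prems(1)] by simp
  with Suc show ?case by simp
qed simp

text \<open>Pigeonhole: there are only finitely many pairs of consecutive residues, so some pair
  recurs.\<close>

lemma gfib_periodic:
  fixes m :: int
  assumes "m > 0"
  shows "\<exists>t>0. \<forall>n. [gfib a b (n + t) = gfib a b n] (mod m)"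
proof -
  let ?s = "\<lambda>n. (gfib a b n mod m, gfib a b (Suc n) mod m)"
  have "range ?s \<subseteq> {0..<m} \<times> {0..<m}"
    using assms by auto
  then have "finite (range ?s)"
    by (rule finite_subset) auto
  then have "\<not> inj ?s"
    using finite_imageD infinite_UNIV_nat by blast
  then obtain i j where "i < j" and eq: "?s i = ?s j"
    using linorder_injI[of ?s] by blast
  then obtain t where t: "j = i + t" "t > 0"
    by (metis less_imp_add_positive)
  have "[gfib a b 0 = gfib a b t] (mod m) \<and> [gfib a b (Suc 0) = gfib a b (Suc t)] (mod m)"
    using eq by (intro gfib_cong_back[of a b i]) (auto simp: t cong_def)
  then have "[gfib a b (n + t) = gfib a b n] (mod m)" for n
    using gfib_congI[of a b 0 t m n] by (auto simp: cong_sym)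
  with \<open>t > 0\<close> show ?thesis by blast
qed

text \<open>An admissible \<open>t\<close> exists, so \<open>LEAST\<close> attains it and the
  definition yields a genuine period.\<close>

lemma pisano_period:
  assumes "p > 0"
  shows "pisano_period p a b > 0"
    and "[gfib a b (n + pisano_period p a b) = gfib a b n] (mod int p)"
  using LeastI_ex[OF gfib_periodic[of "int p" a b]] assms
  unfolding pisano_period_def by auto

lemma Legendre_cong: "[x = y] (mod p) \<Longrightarrow> Legendre x p = Legendre y p"
  by (simp add: Legendre_def QuadRes_def cong_def)

section \<open>Sums of periodic functions over full periods\<close>

lemma periodic_add_mult:
  fixes f :: "nat \<Rightarrow> 'a"
  assumes "\<And>n. f (n + t) = f n"
  shows "f (n + q * t) = f n"
proof (induction q)
  case (Suc q)
  then show ?case using assms[of "n + q * t"] by (simp add: ac_simps)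
qed simp

text \<open>Moving the window one step drops \<open>f m\<close> and gains \<open>f (m + t)\<close>,
  which is the same value; cancelling it requires the type class.\<close>

lemma sum_periodic_shift:
  fixes f :: "nat \<Rightarrow> 'a::cancel_comm_monoid_add"
  assumes "\<And>n. f (n + t) = f n"
  shows "(\<Sum>i<t. f (i + m)) = (\<Sum>i<t. f i)"
proof (induction m)
  case (Suc m)
  have "f m + (\<Sum>i<t. f (i + Suc m)) = (\<Sum>i<Suc t. f (i + m))"
    by (subst sum.lessThan_Suc_shift) simp
  also have "\<dots> = f m + (\<Sum>i<t. f (i + m))"
    using assms[of m] by (simp add: ac_simps)
  finally show ?case using Suc by simp
qed simp

lemma sum_periodic_mult:
  fixes f :: "nat \<Rightarrow> 'a::{semiring_1, cancel_comm_monoid_add}"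
  assumes "\<And>n. f (n + t) = f n"
  shows "(\<Sum>i<q * t. f (i + m)) = of_nat q * (\<Sum>i<t. f i)"
proof -
  have "(\<Sum>i<q * t. f (i + m)) = (\<Sum>i<q * t. f i)"
    using assms by (intro sum_periodic_shift periodic_add_mult)
  \<comment> \<open>Cut the range into \<open>q\<close> consecutive blocks of length
    \<open>t\<close>.\<close>
  also have "\<dots> = (\<Sum>k<q. \<Sum>i<t. f (i + k * t))"
    unfolding sum.nat_group[symmetric]
    by (simp add: sum.atLeastLessThan_shift_0[of _ "_ * t"] lessThan_atLeast0 ac_simps)
  also have "\<dots> = of_nat q * (\<Sum>i<t. f i)"
    using assms by (simp add: periodic_add_mult)
  finally show ?thesis .
qed

section \<open>The structure of the wheel\<close>

definition rim_edge :: "nat \<Rightarrow> nat \<Rightarrow> nat set" where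
  "rim_edge N i = {i, if i = N then 1 else Suc i}"

lemma verts_wheel: "verts (wheel_graph (Suc N)) = {0..<Suc N}"
  unfolding verts_def wheel_graph_def cycle_graph_def by auto

text \<open>Naming each rim edge by its starting vertex makes the closing edge the case
  \<open>i = N\<close>, so rim and spokes are both indexed by \<open>{1..N}\<close>.\<close>

lemma edges_wheel:
  assumes "N \<ge> 1"
  shows "edges (wheel_graph (Suc N)) = rim_edge N ` {1..N} \<union> (\<lambda>v. {0, v}) ` {1..N}"
proof -
  have "{{i, i + 1} | i. 1 \<le> i \<and> i \<le> N - 1} \<union> {{1, N}} = rim_edge N ` {1..N}" (is "?L = ?R")
  proof
    have "{i, i + 1} \<in> ?R" if "1 \<le> i" "i \<le> N - 1" for i
      using that by (intro image_eqI[of _ _ i]) (auto simp: rim_edge_def)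
    moreover have "{1, N} \<in> ?R"
      using assms by (intro image_eqI[of _ _ N]) (auto simp: rim_edge_def)
    ultimately show "?L \<subseteq> ?R" by blast
    show "?R \<subseteq> ?L"
    proof
      fix e assume "e \<in> ?R"
      then obtain i where i: "1 \<le> i" "i \<le> N" "e = rim_edge N i" by auto
      show "e \<in> ?L"
      proof (cases "i = N")
        case True
        with i show ?thesis by (auto simp: rim_edge_def)
      next
        case False
        with i have "i \<le> N - 1" "e = {i, i + 1}" by (auto simp: rim_edge_def)
        with i show ?thesis by blast
      qed
    qed
  qed
  then show ?thesis
    unfolding edges_def verts_def wheel_graph_def cycle_graph_def by auto
qed

text \<open>For \<open>N = 1\<close> the closing edge \<open>{1, N}\<close> would be a loop.\<close>

lemma simple_graph_wheel:
  assumes "N \<ge> 2"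
  shows "simple_graph (wheel_graph (Suc N))"
  unfolding simple_graph_def verts_wheel
  using assms by (auto simp: edges_wheel rim_edge_def)

lemma connected_graph_wheel:
  assumes "N \<ge> 1"
  shows "connected_graph (wheel_graph (Suc N))"
proof -
  let ?R = "{(x, y). {x, y} \<in> edges (wheel_graph (Suc N))}"
  have "(v, 0) \<in> ?R\<^sup>* \<and> (0, v) \<in> ?R\<^sup>*" if "v \<in> verts (wheel_graph (Suc N))" for v
  proof (cases "v = 0")
    case False
    with that have "{0, v} \<in> edges (wheel_graph (Suc N))"
      by (auto simp: verts_wheel edges_wheel[OF assms])
    then show ?thesis by (auto simp: insert_commute intro!: r_into_rtrancl)
  qed simp
  moreover have "0 \<in> verts (wheel_graph (Suc N))"
    by (simp add: verts_wheel)
  ultimately show ?thesis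
    unfolding connected_graph_def by (blast intro: rtrancl_trans)
qed

text \<open>For \<open>N = 2\<close> both rim edges would be \<open>{1, 2}\<close>.\<close>

lemma inj_on_rim_edge:
  assumes "N \<ge> 3"
  shows "inj_on (rim_edge N) {1..N}"
  using assms by (auto simp: inj_on_def rim_edge_def doubleton_eq_iff split: if_splits)

text \<open>Counting edges becomes summing over indices: both families are indexed injectively, and
  only spokes contain the hub 0.\<close>

lemma card_wheel_edges_filter:
  assumes "N \<ge> 3"
  shows "card {e \<in> edges (wheel_graph (Suc N)). P e} =
    (\<Sum>i = 1..N. of_bool (P (rim_edge N i))) + (\<Sum>i = 1..N. of_bool (P {0, i}))"
proof -
  have "card {e \<in> edges (wheel_graph (Suc N)). P e} =
    (\<Sum>e \<in> rim_edge N ` {1..N} \<union> (\<lambda>v. {0, v}) ` {1..N}. of_bool (P e))"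
    using assms by (simp add: edges_wheel Int_def)
  also have "\<dots> = (\<Sum>e \<in> rim_edge N ` {1..N}. of_bool (P e)) +
      (\<Sum>e \<in> (\<lambda>v. {0, v}) ` {1..N}. of_bool (P e))"
    by (rule sum.union_disjoint) (auto simp: rim_edge_def doubleton_eq_iff split: if_splits)
  also have "(\<Sum>e \<in> rim_edge N ` {1..N}. of_bool (P e)) =
      ((\<Sum>i = 1..N. of_bool (P (rim_edge N i))) :: nat)"
    by (subst sum.reindex[OF inj_on_rim_edge[OF assms]]) (simp add: comp_def)
  also have "(\<Sum>e \<in> (\<lambda>v. {0, v}) ` {1..N}. of_bool (P e)) =
      ((\<Sum>i = 1..N. of_bool (P {0, i})) :: nat)"
    by (subst sum.reindex) (auto simp: inj_on_def doubleton_eq_iff simp del: sum_of_bool_eq)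
  finally show ?thesis .
qed

section \<open>Edge labels and their counts\<close>

lemma edge_label_eq:
  "edge_label a b p f u v =
    of_bool (Legendre (gfib a b (f u) + gfib a b (f v)) (int p) = 1)"
  \<comment> \<open>A sum divisible by \<open>p\<close> has symbol 0, so symbols 0 and -1 share the
    label 0.\<close>
  by (auto simp: edge_label_def Legendre_def)

text \<open>The label is expressed through the edge as a set. This needs distinct endpoints, since a
  sum over \<open>{u, u}\<close> would have a single term.\<close>

lemma label_count_eq:
  assumes "simple_graph G"
  shows "label_count a b p G f i =
    card {e \<in> edges G. of_bool (Legendre (\<Sum>x\<in>e. gfib a b (f x)) (int p) = 1) = i}"
proof -
  have edge: "\<exists>u v. e = {u, v} \<and> u \<noteq> v" if "e \<in> edges G" for e
    using that assms unfolding simple_graph_def card_2_iff by blast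
  have label: "edge_label a b p f u v =
      of_bool (Legendre (\<Sum>x\<in>{u, v}. gfib a b (f x)) (int p) = 1)"
    if "{u, v} \<in> edges G" for u v
  proof -
    have "u \<noteq> v"
      using edge[OF that] by auto
    then show ?thesis by (simp add: edge_label_eq)
  qed
  have "{{u, v} | u v. {u, v} \<in> edges G \<and> edge_label a b p f u v = i} =
    {e \<in> edges G. of_bool (Legendre (\<Sum>x\<in>e. gfib a b (f x)) (int p) = 1) = i}"
    (is "?L = ?R")
  proof
    show "?L \<subseteq> ?R"
      using label by auto
    show "?R \<subseteq> ?L"
    proof
      fix e assume e: "e \<in> ?R"
      then obtain u v where "e = {u, v}"
        using edge by blast
      with e label show "e \<in> ?L" by blast
    qed
  qed
  then show ?thesis by (simp add: label_count_def)
qed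

section \<open>The period of a 0-PL prime\<close>

lemma PL_prime_zero_period:
  assumes "PL_prime 0 p a b"
  shows "2 * card (Lambda_set 1 p a b) = pisano_period p a b"
proof -
  let ?A = "\<lambda>j. Lambda_set j p a b"
  have fin: "finite (?A j)" for j
    by (simp add: Lambda_set_def)
  \<comment> \<open>The symbol takes no other values, so the three classes partition a period; being
    0-PL makes the first as large as the other two together.\<close>
  have "{0..<pisano_period p a b} = ?A 1 \<union> (?A (-1) \<union> ?A 0)"
    by (auto simp: Lambda_set_def Legendre_def)
  then have "pisano_period p a b = card (?A 1 \<union> (?A (-1) \<union> ?A 0))"
    by (metis card_atLeastLessThan diff_zero)
  also have "\<dots> = card (?A 1) + (card (?A (-1)) + card (?A 0))"
    using fin by (subst card_Un_disjoint; auto simp: Lambda_set_def card_Un_disjoint)+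
  finally show ?thesis
    using assms by (simp add: PL_prime_def)
qed

text \<open>This makes the rim a proper cycle. The period is even, and period 2 would give
  \<open>b\<close> = F_2 \<equiv> F_0 = 0, so that no symbol would be 1.\<close>

lemma PL_prime_zero_period_ge:
  assumes "PL_prime 0 p 0 b"
  shows "pisano_period p 0 b \<ge> 3"
proof -
  let ?t = "pisano_period p 0 b"
  have "p > 0"
    using assms prime_gt_0_nat by (auto simp: PL_prime_def)
  note per = pisano_period[OF this, where a = 0 and b = b]
  have even: "even ?t"
    using PL_prime_zero_period[OF assms] by (metis dvd_triv_left)
  moreover have "?t \<noteq> 2"
  proof
    assume t: "?t = 2"
    from per(2)[of 0] have "[b = 0] (mod int p)"
      by (simp add: t numeral_2_eq_2)
    then have "Legendre (gfib 0 b i) (int p) = 0" if "i < 2" for i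
      using that by (auto simp: Legendre_def less_2_cases_iff)
    then have "Lambda_set 1 p 0 b = {}"
      by (auto simp: Lambda_set_def t)
    with PL_prime_zero_period[OF assms] t show False by simp
  qed
  ultimately show ?thesis
    using per(1) by (cases "?t = 1") auto
qed

theorem theorem3p3:
  fixes b :: int and p q :: nat
  assumes "b \<noteq> 0"
    and "0 \<in> pisano_set 0 b"
    and "PL_prime 0 p 0 b"
    and "q \<ge> 1"
  shows "FLC_graph 0 b p (wheel_graph (q * pisano_period p 0 b + 1))"
proof -
  define t where "t = pisano_period p 0 b"
  define N where "N = q * t"
  define F where "F = gfib 0 b"
  define L where "L x \<longleftrightarrow> Legendre x (int p) = 1" for x
  define G where "G = wheel_graph (Suc N)"
  have "p > 0"
    using assms(3) prime_gt_0_nat by (auto simp: PL_prime_def)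
  note per = pisano_period[OF this, where a = 0 and b = b, folded t_def F_def]
  have L_cong: "L x = L y" if "[x = y] (mod int p)" for x y
    using Legendre_cong[OF that] by (simp add: L_def)
  have L_per: "L (F (n + t)) = L (F n)" for n
    by (rule L_cong) (rule per(2))
  have "1 * 3 \<le> q * t"
    using PL_prime_zero_period_ge[OF assms(3)] assms(4) unfolding t_def by (rule mult_le_mono[rotated])
  then have N: "N \<ge> 3" by (simp add: N_def)
  have simple: "simple_graph G"
    using N by (simp add: G_def simple_graph_wheel del: One_nat_def)
  have FN: "[F (n + N) = F n] (mod int p)" for n
    using periodic_add_mult[of "\<lambda>n. F n mod int p" t n q] per(2) by (simp add: N_def cong_def)

  have "{0..<t} \<inter> {i. L (F i)} = Lambda_set 1 p 0 b"
    by (auto simp: Lambda_set_def t_def F_def L_def)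
  then have half: "2 * (\<Sum>i<t. of_bool (L (F i))) = t"
    using PL_prime_zero_period[OF assms(3)] by (simp add: t_def lessThan_atLeast0)
  \<comment> \<open>The offset is left free: spokes use \<open>m = 0\<close> and rim edges
    \<open>m = 2\<close>.\<close>
  have shift: "2 * (\<Sum>i = 1..N. of_bool (L (F (i + m)))) = N" for m
  proof -
    have "(\<Sum>i = 1..N. of_bool (L (F (i + m)))) = (\<Sum>i<N. of_bool (L (F (i + Suc m))) :: nat)"
      by (rule sum.reindex_bij_witness[of _ Suc "\<lambda>i. i - 1"]) auto
    also have "\<dots> = q * (\<Sum>i<t. of_bool (L (F i)))"
      using sum_periodic_mult[of "\<lambda>i. of_bool (L (F i)) :: nat" t "Suc m" q] L_per
      by (simp add: N_def del: sum_of_bool_eq)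
    finally show ?thesis
      using half by (simp add: N_def del: sum_of_bool_eq)
  qed

  have rim: "L (\<Sum>x\<in>rim_edge N i. F x) = L (F (i + 2))" if "i \<in> {1..N}" for i
  proof (cases "i = N")
    case True
    \<comment> \<open>The closing edge has F_N + F_1 \<equiv> F_0 + F_1 \<equiv> F_N + F_(N+1) =
      F_(N+2), a congruence modulo \<open>p\<close> only, while the other rim edges give equalities
      of integers.\<close>
    have "[F 0 + F 1 = F N + F (N + 1)] (mod int p)"
      using FN[of 0] FN[of 1] by (auto intro!: cong_add simp: cong_sym add.commute)
    moreover have "[F N + F 1 = F 0 + F 1] (mod int p)"
      using FN[of 0] by (auto intro!: cong_add)
    ultimately have "[F N + F 1 = F (N + 2)] (mod int p)"
      by (auto simp: F_def add.commute intro: cong_trans)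
    then have "L (F N + F 1) = L (F (N + 2))" by (rule L_cong)
    with True N show ?thesis by (simp add: rim_edge_def)
  next
    case False
    then show ?thesis by (auto simp: rim_edge_def F_def add.commute)
  qed
  have spoke: "L (\<Sum>x\<in>{0, i}. F x) = L (F (i + 0))" if "i \<in> {1..N}" for i
    using that by (auto simp: F_def)

  \<comment> \<open>Rim and spokes contribute N/2 each, half of the 2N edges in total.\<close>
  have count: "card {e \<in> edges G. L (\<Sum>x\<in>e. F x)} = N"
    unfolding G_def card_wheel_edges_filter[OF N]
    using shift[of 2] shift[of 0] by (simp only: rim spoke cong: sum.cong)
  have total: "card (edges G) = 2 * N"
    unfolding G_def using card_wheel_edges_filter[OF N, of "\<lambda>_. True"] by simp
  have "{e \<in> edges G. \<not> L (\<Sum>x\<in>e. F x)} = edges G - {e \<in> edges G. L (\<Sum>x\<in>e. F x)}"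
    by blast
  moreover have "finite (edges G)"
    using N total by (intro card_ge_0_finite) simp
  ultimately have count': "card {e \<in> edges G. \<not> L (\<Sum>x\<in>e. F x)} = N"
    using count total by (simp add: card_Diff_subset)

  \<comment> \<open>The vertices are already numbered from 0 to \<open>N\<close>, so the identity is
    the labeling; the two label counts are equal.\<close>
  have "FLC_labeling 0 b p G id"
    unfolding FLC_labeling_def label_count_eq[OF simple]
    using count count' by (simp add: L_def F_def) (simp add: G_def verts_wheel)
  then show ?thesis
    using simple connected_graph_wheel[of N] N
    unfolding FLC_graph_def G_def by (auto simp flip: t_def N_def)
qed

end
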